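(* In $L(\mathfrak{sl}_2)^+$ define, for $i\geq 0$, $$A^{\downarrow\uparrow}_i=-x\otimes(-t)^i,\qquad B^{\downarrow\uparrow}_i=(y\otimes t+z\otimes(t-1))(-t)^i,\qquad \psi^{\downarrow\uparrow}_i=-y\otimes(-t)^i.$$ Then the Onsager Lie algebra $O$ has a basis $$A^{\downarrow\uparrow}_i,\qquad B^{\downarrow\uparrow}_i,\qquad \psi^{\downarrow\uparrow}_{i+1},\qquad i\in\mathbb{N},$$ where $A^{\downarrow\uparrow}_0=-A$ and $B^{\downarrow\uparrow}_0=B$. The Lie bracket acts on this basis as follows. For $i,j\in\mathbb{N}$, $$\begin{aligned} [A^{\downarrow\uparrow}_i,A^{\downarrow\uparrow}_j]&=0,\\ [B^{\downarrow\uparrow}_i,B^{\downarrow\uparrow}_j]&=0,\\ [\psi^{\downarrow\uparrow}_i,\psi^{\downarrow\uparrow}_j]&=0,\\ [\psi^{\downarrow\uparrow}_i,A^{\downarrow\uparrow}_j]&=2\psi^{\downarrow\uparrow}_{i+j}+2A^{\downarrow\uparrow}_{i+j},\\ [B^{\downarrow\uparrow}_i,\psi^{\downarrow\uparrow}_j]&=2B^{\downarrow\uparrow}_{i+j}+2\psi^{\downarrow\uparrow}_{i+j},\\ [A^{\downarrow\uparrow}_i,B^{\downarrow\uparrow}_j]&=2A^{\downarrow\uparrow}_{i+j}+2B^{\downarrow\uparrow}_{i+j}-4\psi^{\downarrow\uparrow}_{i+j+1}. \end{aligned}$$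
   Context: $\mathbb{F}$ is a field of characteristic zero; $\mathbb{N}=\{0,1,2,\ldots\}$; tensor products are over $\mathbb{F}$. $\mathfrak{sl}_2$ is the Lie algebra over $\mathbb{F}$ with basis $e,f,h$ and $[h,e]=2e$, $[h,f]=-2f$, $[e,f]=h$. Its equitable basis is $x=2e-h$, $y=-2f-h$, $z=h$, which satisfies $[x,y]=2x+2y$, $[y,z]=2y+2z$, $[z,x]=2z+2x$. Let $t$ be an indeterminate and $\mathcal{A}=\mathbb{F}[t,t^{-1},(t-1)^{-1}]$. The three-point $\mathfrak{sl}_2$ loop algebra $L(\mathfrak{sl}_2)^+$ is the vector space $\mathfrak{sl}_2\otimes\mathcal{A}$ with Lie bracket $[u\otimes a,v\otimes b]=[u,v]\otimes ab$. It is a right $\mathcal{A}$-module via $(u\otimes a)b=u\otimes ab$. The Onsager Lie algebra $O$ is the Lie algebra over $\mathbb{F}$ with generators $A,B$ and relations $[A,[A,[A,B]]]=4[A,B]$, $[B,[B,[B,A]]]=4[B,A]$. There is an injective Lie algebra homomorphism $O\to L(\mathfrak{sl}_2)^+$ with $A\mapsto x\otimes 1$, $B\mapsto y\otimes t+z\otimes(t-1)$, and $O$ is identified with its image; so $O$ is the Lie subalgebra of $L(\mathfrak{sl}_2)^+$ generated by $A=x\otimes1$ and $B=y\otimes t+z\otimes(t-1)$. The brackets in the claim are taken in $L(\mathfrak{sl}_2)^+$ (the element with index $0$ of the $\psi$ family does not lie in $O$). *)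

theory Defs
  imports "HOL-Computational_Algebra.Polynomial_Factorial"
begin

section \<open>The ring \<open>\<A> = F[t, 1/t, 1/(t-1)]\<close>\<close>

text \<open>
  The subring of the field of rational functions \<open>F(t)\<close> generated by the constants,
  \<open>t\<close>, \<open>1/t\<close> and \<open>1/(t-1)\<close>.
\<close>

inductive_set three_point_carrier :: "'a::field poly fract set" where
  const: "to_fract [:c:] \<in> three_point_carrier"
| t: "to_fract [:0, 1:] \<in> three_point_carrier"
| inv_t: "inverse (to_fract [:0, 1:]) \<in> three_point_carrier"
| inv_t1: "inverse (to_fract [:0, 1:] - 1) \<in> three_point_carrier"
| add: "r \<in> three_point_carrier \<Longrightarrow> s \<in> three_point_carrier \<Longrightarrow> r + s \<in> three_point_carrier"
| mult: "r \<in> three_point_carrier \<Longrightarrow> s \<in> three_point_carrier \<Longrightarrow> r * s \<in> three_point_carrier"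

typedef (overloaded) 'a three_point = "three_point_carrier :: 'a::field poly fract set"
  by (rule exI, rule three_point_carrier.t)

setup_lifting type_definition_three_point

lemma three_point_carrier_0: "0 \<in> three_point_carrier"
  using three_point_carrier.const[of 0] by simp

lemma three_point_carrier_1: "1 \<in> three_point_carrier"
  using three_point_carrier.const[of 1] by (simp add: one_pCons[symmetric])

lemma three_point_carrier_uminus:
  assumes "r \<in> three_point_carrier" shows "- r \<in> three_point_carrier"
proof -
  have "to_fract [:-1:] * r = - r"
    by (metis one_pCons minus_pCons minus_zero to_fract_uminus to_fract_1 mult_minus_left mult_1_left)
  then show ?thesis
    using three_point_carrier.mult[OF three_point_carrier.const assms] by metis
qed

lemma three_point_carrier_diff:
  "r \<in> three_point_carrier \<Longrightarrow> s \<in> three_point_carrier \<Longrightarrow> r - s \<in> three_point_carrier"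
  using three_point_carrier.add[OF _ three_point_carrier_uminus] by fastforce

instantiation three_point :: (field) comm_ring_1
begin
lift_definition zero_three_point :: "'a three_point" is 0 by (rule three_point_carrier_0)
lift_definition one_three_point :: "'a three_point" is 1 by (rule three_point_carrier_1)
lift_definition plus_three_point :: "'a three_point \<Rightarrow> 'a three_point \<Rightarrow> 'a three_point"
  is "(+)" by (rule three_point_carrier.add)
lift_definition times_three_point :: "'a three_point \<Rightarrow> 'a three_point \<Rightarrow> 'a three_point"
  is "(*)" by (rule three_point_carrier.mult)
lift_definition uminus_three_point :: "'a three_point \<Rightarrow> 'a three_point"
  is uminus by (rule three_point_carrier_uminus)
lift_definition minus_three_point :: "'a three_point \<Rightarrow> 'a three_point \<Rightarrow> 'a three_point"
  is "(-)" by (rule three_point_carrier_diff)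
instance
  by standard (transfer; simp add: algebra_simps)+
end

lift_definition tp_const :: "'a::field \<Rightarrow> 'a three_point" is "\<lambda>c. to_fract [:c:]"
  by (rule three_point_carrier.const)

lift_definition tp_t :: "'a::field three_point" is "to_fract [:0, 1:]"
  by (rule three_point_carrier.t)

lemma tp_const_simps [simp]:
  "tp_const 0 = 0" "tp_const 1 = 1"
  "tp_const (c + d) = tp_const c + tp_const d"
  "tp_const (c * d) = tp_const c * tp_const d"
  "tp_const (- c) = - tp_const c"
  "tp_const (c - d) = tp_const c - tp_const d"
proof -
  show "tp_const 0 = 0" by transfer simp
  show "tp_const 1 = 1" by transfer (simp add: one_pCons[symmetric])
  show "tp_const (c + d) = tp_const c + tp_const d"
    by transfer (simp flip: to_fract_add)
  show "tp_const (c * d) = tp_const c * tp_const d"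
    by transfer (simp flip: to_fract_mult)
  show "tp_const (- c) = - tp_const c"
    by transfer (simp flip: to_fract_uminus)
  show "tp_const (c - d) = tp_const c - tp_const d"
    by transfer (simp flip: to_fract_diff)
qed

lemma tp_const_numeral [simp]: "tp_const (numeral n) = numeral n"
proof -
  have "tp_const (of_nat k) = of_nat k" for k by (induction k) simp_all
  from this[of "numeral n"] show ?thesis by simp
qed


section \<open>The Lie algebra \<open>sl\<^sub>2\<close>\<close>

text \<open>
  \<open>Sl2 a b c\<close> stands for \<open>a e + b f + c h\<close>. The coefficient ring is left open so that the
  same type also serves as \<open>sl\<^sub>2 \<otimes> \<A>\<close>, the free \<open>\<A>\<close>-module on
  \<open>e \<otimes> 1\<close>, \<open>f \<otimes> 1\<close>, \<open>h \<otimes> 1\<close>.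
\<close>

datatype 'r sl2 = Sl2 (e_coord: 'r) (f_coord: 'r) (h_coord: 'r)

instantiation sl2 :: (ab_group_add) ab_group_add
begin
definition zero_sl2 :: "'a sl2" where "0 = Sl2 0 0 0"
definition plus_sl2 :: "'a sl2 \<Rightarrow> 'a sl2 \<Rightarrow> 'a sl2" where
  "u + v = Sl2 (e_coord u + e_coord v) (f_coord u + f_coord v) (h_coord u + h_coord v)"
definition minus_sl2 :: "'a sl2 \<Rightarrow> 'a sl2 \<Rightarrow> 'a sl2" where
  "u - v = Sl2 (e_coord u - e_coord v) (f_coord u - f_coord v) (h_coord u - h_coord v)"
definition uminus_sl2 :: "'a sl2 \<Rightarrow> 'a sl2" where
  "- u = Sl2 (- e_coord u) (- f_coord u) (- h_coord u)"
instance
  by standard (auto simp: zero_sl2_def plus_sl2_def minus_sl2_def uminus_sl2_def algebra_simps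
      intro: sl2.expand)
end

lemmas sl2_ops_defs = zero_sl2_def plus_sl2_def minus_sl2_def uminus_sl2_def

definition sl2_scale :: "'r::comm_ring_1 \<Rightarrow> 'r sl2 \<Rightarrow> 'r sl2" where
  "sl2_scale r u = Sl2 (r * e_coord u) (r * f_coord u) (r * h_coord u)"

text \<open>The bilinear extension of \<open>[h,e] = 2e\<close>, \<open>[h,f] = -2f\<close>, \<open>[e,f] = h\<close>.\<close>

definition lie :: "'r::comm_ring_1 sl2 \<Rightarrow> 'r sl2 \<Rightarrow> 'r sl2" where
  "lie u v = Sl2
     (2 * (h_coord u * e_coord v - e_coord u * h_coord v))
     (- 2 * (h_coord u * f_coord v - f_coord u * h_coord v))
     (e_coord u * f_coord v - f_coord u * e_coord v)"

definition sl2_e :: "'r::comm_ring_1 sl2" where "sl2_e = Sl2 1 0 0"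
definition sl2_f :: "'r::comm_ring_1 sl2" where "sl2_f = Sl2 0 1 0"
definition sl2_h :: "'r::comm_ring_1 sl2" where "sl2_h = Sl2 0 0 1"

definition sl2_x :: "'r::comm_ring_1 sl2" where "sl2_x = sl2_scale 2 sl2_e - sl2_h"
definition sl2_y :: "'r::comm_ring_1 sl2" where "sl2_y = sl2_scale (- 2) sl2_f - sl2_h"
definition sl2_z :: "'r::comm_ring_1 sl2" where "sl2_z = sl2_h"

lemmas sl2_basis_defs = sl2_e_def sl2_f_def sl2_h_def sl2_x_def sl2_y_def sl2_z_def

lemma lie_efh:
  "lie sl2_h sl2_e = sl2_scale 2 sl2_e"
  "lie sl2_h sl2_f = sl2_scale (- 2) sl2_f"
  "lie sl2_e sl2_f = sl2_h"
  by (simp_all add: lie_def sl2_basis_defs sl2_scale_def)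

lemma lie_xyz:
  "lie sl2_x sl2_y = sl2_scale 2 sl2_x + sl2_scale 2 sl2_y"
  "lie sl2_y sl2_z = sl2_scale 2 sl2_y + sl2_scale 2 sl2_z"
  "lie sl2_z sl2_x = sl2_scale 2 sl2_z + sl2_scale 2 sl2_x"
  by (simp_all add: lie_def sl2_basis_defs sl2_scale_def sl2_ops_defs)

lemma lie_alternating: "lie u u = 0"
  by (simp add: lie_def sl2_ops_defs algebra_simps)

lemma lie_jacobi: "lie u (lie v w) + lie v (lie w u) + lie w (lie u v) = 0"
  by (simp add: lie_def sl2_ops_defs algebra_simps)

lemma lie_bilinear:
  "lie (u + u') v = lie u v + lie u' v"
  "lie u (v + v') = lie u v + lie u v'"
  "lie (sl2_scale r u) v = sl2_scale r (lie u v)"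
  "lie u (sl2_scale r v) = sl2_scale r (lie u v)"
  by (simp_all add: lie_def sl2_scale_def sl2_ops_defs algebra_simps)


section \<open>The three-point loop algebra \<open>L(sl\<^sub>2)\<^sup>+ = sl\<^sub>2 \<otimes> \<A>\<close>\<close>

type_synonym 'a loop = "'a three_point sl2"

definition tensor :: "'a::field sl2 \<Rightarrow> 'a three_point \<Rightarrow> 'a loop"  (infixl "\<otimes>" 75) where
  "u \<otimes> a = Sl2 (tp_const (e_coord u) * a) (tp_const (f_coord u) * a) (tp_const (h_coord u) * a)"

definition loop_act :: "'a::field loop \<Rightarrow> 'a three_point \<Rightarrow> 'a loop"  (infixl "\<cdot>" 74) where
  "w \<cdot> b = sl2_scale b w"

definition tp_scale :: "'a::field \<Rightarrow> 'a three_point \<Rightarrow> 'a three_point" where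
  "tp_scale c a = tp_const c * a"

definition loop_scale :: "'a::field \<Rightarrow> 'a loop \<Rightarrow> 'a loop" where
  "loop_scale c w = sl2_scale (tp_const c) w"

interpretation sl2: vector_space "sl2_scale :: 'a::field \<Rightarrow> 'a sl2 \<Rightarrow> 'a sl2"
  by standard (simp_all add: sl2_scale_def sl2_ops_defs algebra_simps)

interpretation tp: vector_space "tp_scale :: 'a::field \<Rightarrow> 'a three_point \<Rightarrow> 'a three_point"
  by standard (simp_all add: tp_scale_def algebra_simps)

interpretation loop: vector_space "loop_scale :: 'a::field \<Rightarrow> 'a loop \<Rightarrow> 'a loop"
  by standard (simp_all add: loop_scale_def sl2_scale_def sl2_ops_defs algebra_simps)

lemma lie_tensor: "lie (u \<otimes> a) (v \<otimes> b) = lie u v \<otimes> (a * b)"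
  by (simp add: lie_def tensor_def algebra_simps)

lemma tensor_act: "(u \<otimes> a) \<cdot> b = u \<otimes> (a * b)"
  by (simp add: loop_act_def tensor_def sl2_scale_def algebra_simps)

lemma tensor_bilinear:
  "(u + u') \<otimes> a = u \<otimes> a + u' \<otimes> a"
  "u \<otimes> (a + a') = u \<otimes> a + u \<otimes> a'"
  "sl2_scale c u \<otimes> a = loop_scale c (u \<otimes> a)"
  "u \<otimes> tp_scale c a = loop_scale c (u \<otimes> a)"
  by (simp_all add: tensor_def sl2_scale_def tp_scale_def loop_scale_def sl2_ops_defs
      algebra_simps)

lemma loop_eq_tensors:
  "w = sl2_e \<otimes> e_coord w + sl2_f \<otimes> f_coord w + sl2_h \<otimes> h_coord w"
  by (simp add: tensor_def sl2_basis_defs sl2_ops_defs)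

text \<open>
  The universal property: \<open>'a loop\<close> together with \<open>(\<otimes>)\<close> is a tensor product of \<open>sl\<^sub>2\<close> and
  \<open>\<A>\<close> over the ground field.
\<close>

lemma tensor_universal:
  fixes scale :: "'a::field \<Rightarrow> 'v::ab_group_add \<Rightarrow> 'v"
    and \<phi> :: "'a sl2 \<Rightarrow> 'a three_point \<Rightarrow> 'v"
  assumes left: "\<And>a. Vector_Spaces.linear sl2_scale scale (\<lambda>u. \<phi> u a)"
    and right: "\<And>u. Vector_Spaces.linear tp_scale scale (\<phi> u)"
  shows "\<exists>!g. Vector_Spaces.linear loop_scale scale g \<and> (\<forall>u a. g (u \<otimes> a) = \<phi> u a)"
proof (rule ex1I)
  let ?g = "\<lambda>w. \<phi> sl2_e (e_coord w) + \<phi> sl2_f (f_coord w) + \<phi> sl2_h (h_coord w)"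
  interpret R: Vector_Spaces.linear tp_scale scale "\<phi> u" for u by (rule right)
  interpret L: Vector_Spaces.linear sl2_scale scale "\<lambda>u. \<phi> u a" for a by (rule left)
  have act: "\<phi> u (tp_const c * a) = scale c (\<phi> u a)" for u c a
    using R.scale[of u c a] by (simp add: tp_scale_def)
  have "Vector_Spaces.linear loop_scale scale ?g"
    by (intro Vector_Spaces.linear.intro module_hom.intro module_hom_axioms.intro
         loop.vector_space_axioms loop.module_axioms R.vs2.vector_space_axioms
         R.vs2.module_axioms)
       (simp_all add: loop_scale_def sl2_scale_def plus_sl2_def R.add act
         R.vs2.scale_right_distrib)
  moreover have "?g (u \<otimes> a) = \<phi> u a" for u a
  proof -
    have "u = sl2_scale (e_coord u) sl2_e + sl2_scale (f_coord u) sl2_f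
            + sl2_scale (h_coord u) sl2_h"
      by (simp add: sl2_scale_def sl2_basis_defs sl2_ops_defs)
    then have "\<phi> u a = scale (e_coord u) (\<phi> sl2_e a) + scale (f_coord u) (\<phi> sl2_f a)
            + scale (h_coord u) (\<phi> sl2_h a)"
      by (metis L.add L.scale)
    then show ?thesis by (simp add: tensor_def act)
  qed
  ultimately show "Vector_Spaces.linear loop_scale scale ?g \<and> (\<forall>u a. ?g (u \<otimes> a) = \<phi> u a)"
    by blast
  fix g assume g: "Vector_Spaces.linear loop_scale scale g \<and> (\<forall>u a. g (u \<otimes> a) = \<phi> u a)"
  then interpret G: Vector_Spaces.linear loop_scale scale g by blast
  show "g = ?g"
  proof
    fix w
    have "g w = g (sl2_e \<otimes> e_coord w + sl2_f \<otimes> f_coord w + sl2_h \<otimes> h_coord w)"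
      using loop_eq_tensors[of w] by metis
    then show "g w = ?g w" using g by (simp only: G.add)
  qed
qed


section \<open>The Onsager Lie algebra\<close>

definition lie_subalgebra :: "'a::field loop set \<Rightarrow> bool" where
  "lie_subalgebra S \<longleftrightarrow> loop.subspace S \<and> (\<forall>u\<in>S. \<forall>v\<in>S. lie u v \<in> S)"

definition onsager_A :: "'a::field loop" where
  "onsager_A = sl2_x \<otimes> 1"

definition onsager_B :: "'a::field loop" where
  "onsager_B = sl2_y \<otimes> tp_t + sl2_z \<otimes> (tp_t - 1)"

definition onsager :: "'a::field loop set" where
  "onsager = lie_subalgebra hull {onsager_A, onsager_B}"

lemma lie_subalgebra_onsager: "lie_subalgebra (onsager :: 'a::field loop set)"
  unfolding onsager_def
  by (rule hull_in) (auto simp: lie_subalgebra_def loop.subspace_def)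

text \<open>The defining relations of the abstract Onsager Lie algebra.\<close>

lemma onsager_relations:
  "lie onsager_A (lie onsager_A (lie onsager_A onsager_B)) = loop_scale 4 (lie onsager_A onsager_B)"
  "lie onsager_B (lie onsager_B (lie onsager_B onsager_A)) = loop_scale 4 (lie onsager_B onsager_A)"
  by (simp_all add: onsager_A_def onsager_B_def lie_def tensor_def loop_scale_def sl2_scale_def
      sl2_basis_defs sl2_ops_defs algebra_simps)

definition A_du :: "nat \<Rightarrow> 'a::field loop" where
  "A_du i = - (sl2_x \<otimes> (- tp_t) ^ i)"

definition B_du :: "nat \<Rightarrow> 'a::field loop" where
  "B_du i = (sl2_y \<otimes> tp_t + sl2_z \<otimes> (tp_t - 1)) \<cdot> (- tp_t) ^ i"

definition psi_du :: "nat \<Rightarrow> 'a::field loop" where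
  "psi_du i = - (sl2_y \<otimes> (- tp_t) ^ i)"

text \<open>Injectivity is needed because \<open>range b\<close> forgets repetitions in the family.\<close>

definition is_basis_of :: "('i \<Rightarrow> 'a::field loop) \<Rightarrow> 'a loop set \<Rightarrow> bool" where
  "is_basis_of b W \<longleftrightarrow> inj b \<and> \<not> loop.dependent (range b) \<and> loop.span (range b) = W"

end

theory Submission
  imports Defs
begin

text \<open>
  The bracket relations are identities over \<open>\<A>\<close>; they show that the span of the family is a Lie
  subalgebra. Conversely, \<open>[A\<^sub>i, B\<^sub>0]\<close> produces \<open>\<psi>\<^sub>i\<^sub>+\<^sub>1\<close> from \<open>A\<^sub>i, B\<^sub>i\<close>, and then \<open>[\<psi>\<^sub>1, A\<^sub>i]\<close> and
  \<open>[B\<^sub>i, \<psi>\<^sub>1]\<close> produce \<open>A\<^sub>i\<^sub>+\<^sub>1\<close> and \<open>B\<^sub>i\<^sub>+\<^sub>1\<close>, so the family lies in \<open>O\<close>. For independence put \<open>s = -t\<close>: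
  a relation with coefficient polynomials \<open>a, b, c\<close> has \<open>e, f, h\<close>-coordinates \<open>-2a(s)\<close>,
  \<open>2s(b(s) + c(s))\<close> and \<open>a(s) - b(s) + s c(s)\<close>; their vanishing gives \<open>a = 0\<close>, \<open>b = -c\<close> and
  \<open>(1 + s) c(s) = 0\<close>.
\<close>

section \<open>Linear independence of indexed families\<close>

lemma (in vector_space) independent_family:
  assumes "\<And>F u. finite F \<Longrightarrow> (\<Sum>i\<in>F. u i *s b i) = 0 \<Longrightarrow> \<forall>i\<in>F. u i = 0"
  shows "inj b \<and> independent (range b)"
proof
  show inj: "inj b"
  proof (rule injI, rule ccontr)
    fix i j assume "b i = b j" "i \<noteq> j"
    \<comment> \<open>Equal vectors at two distinct indices would satisfy the nontrivial relation
      with coefficients 1 and -1.\<close>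
    then have "(\<Sum>k\<in>{i, j}. (if k = i then 1 else - 1) *s b k) = 0"
      by simp
    from assms[OF _ this] show False by auto
  qed
  show "independent (range b)"
    unfolding dependent_explicit
  proof safe
    fix S u v
    assume S: "finite S" "S \<subseteq> range b" "(\<Sum>v\<in>S. u v *s v) = 0" "v \<in> S" "u v \<noteq> 0"
    then obtain F where F: "finite F" "S = b ` F"
      by (metis finite_subset_image)
    have "(\<Sum>i\<in>F. u (b i) *s b i) = 0"
      using S(3) inj by (simp add: F sum.reindex inj_on_def)
    from assms[OF F(1) this] S(4,5) F(2) show False by auto
  qed
qed

section \<open>Polynomials inside the three-point ring\<close>

lemma to_fract_in_three_point_carrier: "to_fract p \<in> three_point_carrier"
proof (induction p)
  case 0
  show ?case by (simp add: three_point_carrier_0)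
next
  case (pCons c p)
  have "to_fract (pCons c p) = to_fract [:c:] + to_fract [:0, 1:] * to_fract p"
    by (simp flip: to_fract_add to_fract_mult)
  with pCons show ?case
    by (metis three_point_carrier.add three_point_carrier.mult three_point_carrier.const
        three_point_carrier.t)
qed

text \<open>The inclusion of F[t] into the three-point ring. Through it the vanishing of an element
  is tested in F[t], where coefficients can be compared.\<close>

definition tp_poly :: "'a::field poly \<Rightarrow> 'a three_point" where
  "tp_poly p = Abs_three_point (to_fract p)"

lemma Rep_tp_poly: "Rep_three_point (tp_poly p) = to_fract p"
  by (simp add: tp_poly_def Abs_three_point_inverse to_fract_in_three_point_carrier)

lemmas tp_rep_simps = Rep_three_point_inject[symmetric] Rep_tp_poly plus_three_point.rep_eq
  times_three_point.rep_eq uminus_three_point.rep_eq zero_three_point.rep_eq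
  one_three_point.rep_eq tp_const.rep_eq tp_t.rep_eq

lemma tp_poly_add: "tp_poly (p + q) = tp_poly p + tp_poly q"
  by (simp add: tp_rep_simps)

lemma tp_poly_mult: "tp_poly (p * q) = tp_poly p * tp_poly q"
  by (simp add: tp_rep_simps)

lemma tp_poly_eq_0_iff: "tp_poly p = 0 \<longleftrightarrow> p = 0"
  by (simp add: tp_rep_simps)

lemma tp_poly_const: "tp_poly [:c:] = tp_const c"
  by (simp add: tp_rep_simps)

lemma tp_poly_minus_t: "tp_poly [:0, - 1:] = - tp_t"
  by (simp add: tp_rep_simps flip: to_fract_uminus)

lemma tp_poly_power: "tp_poly (p ^ k) = tp_poly (p :: 'a::field poly) ^ k"
  proof -
  have "tp_poly 1 = (1 :: 'a three_point)"
    using tp_poly_const[of 1] by (simp flip: one_pCons)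
  then show ?thesis by (induction k) (simp_all add: tp_poly_mult)
qed

text \<open>Turns a combination of powers of -t into the image of a single polynomial, from which
  the coefficients \<open>c i\<close> can be recovered.\<close>

lemma tp_poly_pcompose_minus_t:
  "tp_poly (pcompose (\<Sum>i<n. monom (c i) i) [:0, - 1:]) = (\<Sum>i<n. tp_const (c i) * (- tp_t) ^ i)"
proof (induction n)
  case (Suc n)
  have "pcompose (monom d n) [:0, - 1:] = [:d:] * [:0, - 1:] ^ n" for d :: 'a
    by (induction n) (simp_all add: monom_0 monom_Suc pcompose_pCons)
  \<comment> \<open>\<open>mult_pCons_left\<close> would turn the product with \<open>[:d:]\<close>
    into a scalar multiple, which \<open>tp_poly_mult\<close> does not match.\<close>
  then show ?case
    using Suc by (simp add: pcompose_add tp_poly_add tp_poly_mult tp_poly_power tp_poly_const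
        tp_poly_minus_t del: mult_pCons_left)
qed (simp add: tp_poly_eq_0_iff)

section \<open>Coordinates and brackets of the three sequences\<close>

lemma du_coords:
  "A_du i = Sl2 (- 2 * (- tp_t) ^ i) 0 ((- tp_t) ^ i)"
  "B_du i = Sl2 0 (2 * ((- tp_t) * (- tp_t) ^ i)) (- ((- tp_t) ^ i))"
  "psi_du i = Sl2 0 (2 * (- tp_t) ^ i) ((- tp_t) ^ i)"
  by (simp_all add: A_du_def B_du_def psi_du_def tensor_def loop_act_def sl2_basis_defs
      sl2_scale_def sl2_ops_defs algebra_simps)

text \<open>In coordinates these are ring identities in s = -t, and adding indices is multiplying
  powers of s. The shift to \<open>psi_du (i + j + 1)\<close> comes from the factor t in the
  f-coordinate of \<open>B_du\<close>; its h-coordinate has no such factor because -t + (t - 1) =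
  -1.\<close>

lemma du_brackets:
  "lie (A_du i) (A_du j) = 0"
  "lie (B_du i) (B_du j) = 0"
  "lie (psi_du i) (psi_du j) = 0"
  "lie (psi_du i) (A_du j) = loop_scale 2 (psi_du (i + j)) + loop_scale 2 (A_du (i + j))"
  "lie (B_du i) (psi_du j) = loop_scale 2 (B_du (i + j)) + loop_scale 2 (psi_du (i + j))"
  "lie (A_du i) (B_du j) = loop_scale 2 (A_du (i + j)) + loop_scale 2 (B_du (i + j))
             - loop_scale 4 (psi_du (i + j + 1))"
  by (simp_all add: du_coords lie_def loop_scale_def sl2_scale_def sl2_ops_defs power_add
      algebra_simps)

lemma A_du_0: "A_du 0 = - onsager_A"
  by (simp add: A_du_def onsager_A_def)

lemma B_du_0: "B_du 0 = onsager_B"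
  by (simp add: B_du_def onsager_B_def loop_act_def sl2_scale_def)

lemma lie_antisym: "lie u v = - lie v u"
  by (simp add: lie_def sl2_ops_defs algebra_simps)

section \<open>Linear independence of the family\<close>

abbreviation (input) du_family :: "nat + nat + nat \<Rightarrow> 'a::field loop" where
  "du_family \<equiv> case_sum A_du (case_sum B_du (\<lambda>i. psi_du (i + 1)))"

lemma sl2_sum:
  "e_coord (sum g F) = (\<Sum>i\<in>F. e_coord (g i))"
  "f_coord (sum g F) = (\<Sum>i\<in>F. f_coord (g i))"
  "h_coord (sum g F) = (\<Sum>i\<in>F. h_coord (g i))"
  by (induction F rule: infinite_finite_induct; simp add: sl2_ops_defs)+

text \<open>With a common bound \<open>n\<close>, each coordinate of the relation is the image of
  one polynomial, so injectivity of \<open>tp_poly\<close> moves the equations into the integral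
  domain F[t], where nonzero factors cancel.\<close>

lemma du_relation_trivial:
  fixes a b c :: "nat \<Rightarrow> 'a::field_char_0"
  assumes "(\<Sum>i<n. loop_scale (a i) (A_du i)) + (\<Sum>i<n. loop_scale (b i) (B_du i))
     + (\<Sum>i<n. loop_scale (c i) (psi_du (i + 1))) = 0"
  shows "\<forall>i<n. a i = 0 \<and> b i = 0 \<and> c i = 0"
proof -
  let ?s = "[:0, - 1:] :: 'a poly"
  define P where "P d = (\<Sum>i<n. monom (d i) i)" for d :: "nat \<Rightarrow> 'a"
  define Q where "Q d = pcompose (P d) ?s" for d
  have Q: "tp_poly (Q d) = (\<Sum>i<n. tp_const (d i) * (- tp_t) ^ i)" for d
    by (simp add: Q_def P_def tp_poly_pcompose_minus_t)
  have coeffs: "\<forall>i<n. d i = 0" if "Q d = 0" for d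
  proof -
    \<comment> \<open>Composition with a polynomial of positive degree is injective.\<close>
    have "P d = 0"
      using that unfolding Q_def by (subst (asm) pcompose_eq_0_iff) simp_all
    moreover have "coeff (P d) i = d i" if "i < n" for i
      using that by (simp add: P_def coeff_sum)
    ultimately show ?thesis by simp
  qed
  have e: "tp_poly ([:- 2:] * Q a) = 0"
    using arg_cong[OF assms, of e_coord]
    unfolding tp_poly_mult Q tp_poly_const
    by (simp add: sl2_sum du_coords loop_scale_def sl2_scale_def sl2_ops_defs sum_distrib_left
        algebra_simps)
  have f: "tp_poly ([:2:] * ?s * (Q b + Q c)) = 0"
    using arg_cong[OF assms, of f_coord]
    unfolding tp_poly_mult tp_poly_add Q tp_poly_const tp_poly_minus_t
    by (simp add: sl2_sum du_coords loop_scale_def sl2_scale_def sl2_ops_defs sum_distrib_left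
        sum.distrib algebra_simps)
  have h: "tp_poly (Q a + [:- 1:] * Q b + ?s * Q c) = 0"
    using arg_cong[OF assms, of h_coord]
    unfolding tp_poly_mult tp_poly_add Q tp_poly_const tp_poly_minus_t
    by (simp add: sl2_sum du_coords loop_scale_def sl2_scale_def sl2_ops_defs sum_distrib_left
        sum_negf algebra_simps)
  \<comment> \<open>Here and in the next step the constants -2 and 2 cancel because the
    characteristic is zero.\<close>
  have Qa: "Q a = 0"
    using e unfolding tp_poly_eq_0_iff by simp
  have Qb: "Q b = - Q c"
    using f unfolding tp_poly_eq_0_iff mult_eq_0_iff by (simp add: eq_neg_iff_add_eq_0)
  \<comment> \<open>The factor is 1 - t = 1 + s: substituting b = -c turns -b + s c into (1 + s)
    c.\<close>
  have "[:1, - 1:] * Q c = 0"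
    using h unfolding tp_poly_eq_0_iff Qa Qb by simp
  then have Qc: "Q c = 0"
    unfolding mult_eq_0_iff by simp
  show ?thesis
    using coeffs[OF Qa] coeffs[OF Qc] coeffs[of b] Qb Qc by simp
qed

lemma du_family_independent:
  "inj (du_family :: _ \<Rightarrow> 'a::field_char_0 loop) \<and>
   \<not> loop.dependent (range (du_family :: _ \<Rightarrow> 'a loop))"
proof (rule loop.independent_family)
  fix F :: "(nat + nat + nat) set" and u :: "_ \<Rightarrow> 'a"
  assume F: "finite F" and sum0: "(\<Sum>i\<in>F. loop_scale (u i) (du_family i)) = 0"
  \<comment> \<open>Extending \<open>u\<close> by zero lets the sum over \<open>F\<close> be
    enlarged to three full ranges below \<open>n\<close>.\<close>
  define v where "v i = (if i \<in> F then u i else 0)" for i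
  obtain n where n: "F \<subseteq> {..<n} <+> {..<n} <+> {..<n}"
  proof -
    have fin: "finite (Inl -` F)" "finite (Inl -` Inr -` F)" "finite (Inr -` Inr -` F)"
      by (intro finite_vimageI F inj_Inl inj_Inr)+
    then have "finite (Inl -` F \<union> Inl -` Inr -` F \<union> Inr -` Inr -` F)" by blast
    then obtain n where n: "Inl -` F \<union> Inl -` Inr -` F \<union> Inr -` Inr -` F \<subseteq> {..<n}"
      by (metis finite_nat_iff_bounded)
    have "i \<in> {..<n} <+> {..<n} <+> {..<n}" if "i \<in> F" for i
    proof (cases i)
      case (Inr j)
      with that n show ?thesis by (cases j) auto
    qed (use that n in auto)
    then show ?thesis using that by blast
  qed
  have "(\<Sum>i\<in>{..<n} <+> {..<n} <+> {..<n}. loop_scale (v i) (du_family i))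
      = (\<Sum>i\<in>F. loop_scale (u i) (du_family i))"
    by (rule sum.mono_neutral_cong_right) (use n in \<open>auto simp: v_def\<close>)
  then have "(\<Sum>i<n. loop_scale (v (Inl i)) (A_du i))
      + (\<Sum>i<n. loop_scale (v (Inr (Inl i))) (B_du i))
      + (\<Sum>i<n. loop_scale (v (Inr (Inr i))) (psi_du (i + 1))) = 0"
    by (simp add: sum.Plus sum0 add.assoc)
  from du_relation_trivial[OF this]
  have "v i = 0" if "i \<in> {..<n} <+> {..<n} <+> {..<n}" for i
    using that by auto
  then show "\<forall>i\<in>F. u i = 0"
    using n by (metis v_def subsetD)
qed

section \<open>The span of the family is the Onsager algebra\<close>

lemma span_du_lie_closed:
  fixes u v :: "'a::field loop"
  assumes "u \<in> loop.span (range du_family)" "v \<in> loop.span (range du_family)"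
  shows "lie u v \<in> loop.span (range du_family)"
proof -
  let ?S = "loop.span (range (du_family :: _ \<Rightarrow> 'a loop))"
  have base: "du_family k \<in> ?S" for k
    by (intro loop.span_base rangeI)
  have mem: "A_du i \<in> ?S" "B_du i \<in> ?S" "psi_du (Suc i) \<in> ?S" for i
    using base[of "Inl i"] base[of "Inr (Inl i)"] base[of "Inr (Inr i)"] by simp_all
  note closed = loop.span_add loop.span_diff loop.span_scale loop.span_zero mem
  \<comment> \<open>For \<open>psi_du\<close> of positive index the bracket formulas return only
    positive indices, so \<open>psi_du 0\<close>, which is not in the family, never arises.\<close>
  have 1: "lie (A_du i) (A_du j) \<in> ?S" "lie (B_du i) (B_du j) \<in> ?S"
    "lie (psi_du (Suc i)) (psi_du (Suc j)) \<in> ?S"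
    "lie (psi_du (Suc i)) (A_du j) \<in> ?S" "lie (B_du i) (psi_du (Suc j)) \<in> ?S"
    "lie (A_du i) (B_du j) \<in> ?S" for i j
    by (simp_all add: du_brackets closed)
  have 2: "lie (A_du j) (psi_du (Suc i)) \<in> ?S" "lie (psi_du (Suc j)) (B_du i) \<in> ?S"
    "lie (B_du j) (A_du i) \<in> ?S" for i j
    using 1(4-6) by (metis lie_antisym loop.span_neg)+
  have basis: "lie (du_family k) (du_family l) \<in> ?S" for k l
    by (simp add: 1 2 split: sum.split)
  have scale: "lie (loop_scale r x) y = loop_scale r (lie x y)"
    "lie y (loop_scale r x) = loop_scale r (lie y x)" for r and x y :: "'a loop"
    by (simp_all add: loop_scale_def lie_bilinear)
  have zero: "lie 0 x = 0" "lie x 0 = 0" for x :: "'a loop"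
    by (simp_all add: lie_def sl2_ops_defs)
  \<comment> \<open>Bilinear extension one argument at a time: first \<open>u\<close> against a
    member of the family, then \<open>v\<close>.\<close>
  have left: "lie u (du_family l) \<in> ?S" for l
    using assms(1)
  proof (induction rule: loop.span_induct_alt)
    case (step c x y)
    then show ?case using basis by (auto simp: lie_bilinear scale intro!: closed(1,3))
  qed (simp add: zero loop.span_zero)
  show ?thesis
    using assms(2)
  proof (induction rule: loop.span_induct_alt)
    case (step c x y)
    then show ?case using left by (auto simp: lie_bilinear scale intro!: closed(1,3))
  qed (simp add: zero loop.span_zero)
qed

lemma du_family_in_onsager:
  "{A_du i, B_du i, psi_du (i + 1)} \<subseteq> (onsager :: 'a::field_char_0 loop set)"
proof -
  let ?O = "onsager :: 'a loop set"
  have sub: "loop.subspace ?O" and lie: "\<And>u v. u \<in> ?O \<Longrightarrow> v \<in> ?O \<Longrightarrow> lie u v \<in> ?O"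
    using lie_subalgebra_onsager by (auto simp: lie_subalgebra_def)
  note closed = loop.subspace_add[OF sub] loop.subspace_diff[OF sub] loop.subspace_scale[OF sub]
  \<comment> \<open>Applied with \<open>c\<close> equal to 4 and 2, which are nonzero in
    characteristic zero.\<close>
  have unscale: "w \<in> ?O" if "loop_scale c w \<in> ?O" "c \<noteq> 0" for c w
    using closed(3)[OF that(1), of "inverse c"] that(2) by simp
  have AB: "onsager_A \<in> ?O" "onsager_B \<in> ?O"
    unfolding onsager_def by (auto intro: hull_inc)
  have A0: "A_du 0 \<in> ?O"
    using AB loop.subspace_neg[OF sub] by (simp add: A_du_0)
  have B0: "B_du 0 \<in> ?O"
    using AB by (simp add: B_du_0)
  have psi: "psi_du (i + 1) \<in> ?O" if "A_du i \<in> ?O" "B_du i \<in> ?O" for i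
  proof (rule unscale)
    have "loop_scale 4 (psi_du (i + 1))
        = loop_scale 2 (A_du i) + loop_scale 2 (B_du i) - lie (A_du i) (B_du 0 :: 'a loop)"
      by (simp add: du_brackets)
    then show "loop_scale 4 (psi_du (i + 1)) \<in> ?O"
      using that lie B0 by (simp add: closed)
  qed simp
  have "A_du i \<in> ?O \<and> B_du i \<in> ?O"
  proof (induction i)
    case (Suc i)
    have psi1: "psi_du 1 \<in> ?O" using psi[OF A0 B0] by simp
    have psi_i: "psi_du (Suc i) \<in> ?O" using psi[of i] Suc by simp
    \<comment> \<open>Bracketing with \<open>psi_du 1\<close> raises the index by one; the term
      \<open>psi_du (Suc i)\<close> to be subtracted is already in O by the induction
      hypothesis.\<close>
    have "loop_scale 2 (A_du (Suc i))
        = lie (psi_du 1) (A_du i) - loop_scale 2 (psi_du (Suc i) :: 'a loop)"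
      "loop_scale 2 (B_du (Suc i))
        = lie (B_du i) (psi_du 1) - loop_scale 2 (psi_du (Suc i) :: 'a loop)"
      by (simp_all add: du_brackets)
    then have "loop_scale 2 (A_du (Suc i)) \<in> ?O" "loop_scale 2 (B_du (Suc i)) \<in> ?O"
      using Suc lie psi1 psi_i by (simp_all add: closed)
    then show ?case using unscale by (metis zero_neq_numeral)
  qed (use A0 B0 in blast)
  then show ?thesis using psi by blast
qed

text \<open>Both inclusions are minimality arguments: the span is the least subspace containing the
  family, and O is the least Lie subalgebra containing the generators, which up to sign are the
  members of index 0.\<close>

lemma span_du_family: "loop.span (range du_family) = (onsager :: 'a::field_char_0 loop set)"
proof
  have "du_family k \<in> (onsager :: 'a loop set)" for k
    using du_family_in_onsager[where 'a = 'a] by (auto split: sum.split)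
  then show "loop.span (range du_family) \<subseteq> (onsager :: 'a loop set)"
    using lie_subalgebra_onsager by (intro loop.span_minimal) (auto simp: lie_subalgebra_def)
  let ?S = "loop.span (range (du_family :: _ \<Rightarrow> 'a loop))"
  have "du_family (Inl 0) \<in> ?S" "du_family (Inr (Inl 0)) \<in> ?S"
    by (intro loop.span_base rangeI)+
  then have "onsager_A \<in> ?S" "onsager_B \<in> ?S"
    using loop.span_neg by (fastforce simp: A_du_0 B_du_0)+
  moreover have "lie_subalgebra ?S"
    by (simp add: lie_subalgebra_def span_du_lie_closed)
  ultimately show "onsager \<subseteq> ?S"
    unfolding onsager_def by (intro hull_minimal) auto
qed

theorem theorem8p3:
  shows "is_basis_of (case_sum A_du (case_sum B_du (\<lambda>i. psi_du (i + 1))))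
           (onsager :: 'a::field_char_0 loop set)
    \<and> (A_du 0 :: 'a loop) = - onsager_A
    \<and> (B_du 0 :: 'a loop) = onsager_B
    \<and> (\<forall>i j. lie (A_du i) (A_du j) = (0 :: 'a loop))
    \<and> (\<forall>i j. lie (B_du i) (B_du j) = (0 :: 'a loop))
    \<and> (\<forall>i j. lie (psi_du i) (psi_du j) = (0 :: 'a loop))
    \<and> (\<forall>i j. lie (psi_du i) (A_du j)
           = loop_scale 2 (psi_du (i + j)) + loop_scale (2 :: 'a) (A_du (i + j)))
    \<and> (\<forall>i j. lie (B_du i) (psi_du j)
           = loop_scale 2 (B_du (i + j)) + loop_scale (2 :: 'a) (psi_du (i + j)))
    \<and> (\<forall>i j. lie (A_du i) (B_du j)
           = loop_scale 2 (A_du (i + j)) + loop_scale 2 (B_du (i + j))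
             - loop_scale (4 :: 'a) (psi_du (i + j + 1)))"
  unfolding is_basis_of_def
  by (intro conjI allI du_family_independent[THEN conjunct1] du_family_independent[THEN conjunct2]
      span_du_family A_du_0 B_du_0 du_brackets)

end
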